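(* For every pair of complex functions $f$ and $g$ and every integer $n\ge0$, we have $$\mathcal{D}_{\mathrm W}^n(fg)=\sum_{k=0}^nC(n,k)\sum_{j=0}^{n-k}\binom{n-k}{j}\left(\mathcal{A}_{\mathrm W}^{n-k-j}\mathcal{D}_{\mathrm W}^{j+k}f\right)\left(\mathcal{A}_{\mathrm W}^{j}\mathcal{D}_{\mathrm W}^{n-j}g\right),$$ where $$C(n,k)=\left(-\frac14\right)^k\frac{(n-1+k)!}{(n-1-k)!\,k!}$$ for every pair of integers $0\le k\le n$, with the convention that $\frac{(-1)!}{(-1)!}:=1$ and $\frac{1}{(-1)!}:=0$.
   Context: A complex function is a function in one complex variable. The Wilson operator $\mathcal{D}_{\mathrm W}$ and the Wilson averaging operator $\mathcal{A}_{\mathrm W}$ act on complex functions by $$(\mathcal{D}_{\mathrm W}f)(x)=\frac{f((\sqrt x+\frac i2)^2)-f((\sqrt x-\frac i2)^2)}{2i\sqrt x},\qquad(\mathcal{A}_{\mathrm W}f)(x)=\frac{f((\sqrt x+\frac i2)^2)+f((\sqrt x-\frac i2)^2)}{2},$$ where $\sqrt{\cdot}$ is a branch of the complex square root with the imaginary axis as the branch cut; both are independent of the choice of $\sqrt x$. The value of $\mathcal{D}_{\mathrm W}f$ at $0$ is defined as $(\mathcal{D}_{\mathrm W}f)(0):=\lim_{x\to0}(\mathcal{D}_{\mathrm W}f)(x)=f'(-\frac14)$ in case $f$ is differentiable at $-\frac14$. Exponents denote iteration ($\mathcal{D}_{\mathrm W}^0$ and $\mathcal{A}_{\mathrm W}^0$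 are the identity), and $\mathcal{A}_{\mathrm W}^p\mathcal{D}_{\mathrm W}^qf$ means that $\mathcal{D}_{\mathrm W}$ is applied $q$ times first and then $\mathcal{A}_{\mathrm W}$ is applied $p$ times.
   Formalization: The identity is stated pointwise: for all f, g at every x not of the form -(m/2)² with 0≤m<n; at such x it is assumed that A^pD^q f and A^pD^q g are differentiable at -1/4 whenever m+p+q<n, since otherwise values at 0 may not exist and the identity can fail. *)

theory Defs
  imports "HOL-Complex_Analysis.Complex_Analysis"
begin

text \<open>
  \<^term>\<open>csqrt\<close> is one admissible choice of the square root; the lemmas \<open>wilson_quot_eq\<close> and
  \<open>wilson_A_eq\<close> below show that every choice gives the same operators.
\<close>

definition wilson_quot :: "(complex \<Rightarrow> complex) \<Rightarrow> complex \<Rightarrow> complex" where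
  "wilson_quot f x =
     (f ((csqrt x + \<i> / 2)\<^sup>2) - f ((csqrt x - \<i> / 2)\<^sup>2)) / (2 * \<i> * csqrt x)"

text \<open>
  The value at 0 is only meaningful if \<open>f\<close> is differentiable at \<open>-1/4\<close>, in which case it is the
  derivative there (lemma \<open>wilson_D_0\<close>). Otherwise \<^term>\<open>Lim\<close> may return an arbitrary value.
\<close>

definition wilson_D :: "(complex \<Rightarrow> complex) \<Rightarrow> complex \<Rightarrow> complex" where
  "wilson_D f x = (if x = 0 then Lim (at 0) (wilson_quot f) else wilson_quot f x)"

definition wilson_A :: "(complex \<Rightarrow> complex) \<Rightarrow> complex \<Rightarrow> complex" where
  "wilson_A f x = (f ((csqrt x + \<i> / 2)\<^sup>2) + f ((csqrt x - \<i> / 2)\<^sup>2)) / 2"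

text \<open>
  \<open>C(n,k)\<close> for \<open>k \<le> n\<close>. The first two branches are the conventions
  \<open>(-1)! / (-1)! = 1\<close> (for \<open>n = k = 0\<close>) and \<open>1 / (-1)! = 0\<close> (for \<open>n = k \<ge> 1\<close>).
\<close>

definition wilson_C :: "nat \<Rightarrow> nat \<Rightarrow> complex" where
  "wilson_C n k = (- 1 / 4) ^ k *
     (if n = 0 then 1
      else if n \<le> k then 0
      else fact (n - 1 + k) / (fact (n - 1 - k) * fact k))"

text \<open>
  Evaluating \<open>n\<close>-fold compositions of the two operators at \<open>x = z\<^sup>2\<close> uses the values of the
  intermediate functions at the points \<open>(z + \<i> l / 2)\<^sup>2\<close> with \<open>\<bar>l\<bar> \<le> n\<close>. So the value of some
  \<^term>\<open>wilson_D h\<close> at 0 can be involved only if \<open>x = -(m/2)\<^sup>2\<close> with \<open>m < n\<close>. Reaching 0 from there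
  takes at least \<open>m\<close> of the \<open>n\<close> operators and one more is applied at 0, so \<open>h\<close> arises from \<open>f\<close> by
  fewer than \<open>n - m\<close> operators. The predicate requires that \<open>wilson_D\<close> of these functions has a
  value at 0. Only the compositions \<open>A\<^sup>p D\<^sup>q\<close> need to be considered, because
  \<open>D A = A D - D\<^sup>2 / 2\<close>. At all other points \<open>x\<close> nothing is required
  (lemma \<open>wilson_defined_generic\<close>), and for entire \<open>f\<close> the predicate holds everywhere
  (lemma \<open>wilson_defined_entire\<close>).
\<close>

definition wilson_defined :: "nat \<Rightarrow> (complex \<Rightarrow> complex) \<Rightarrow> complex \<Rightarrow> bool" where
  "wilson_defined n f x \<longleftrightarrow>
     (\<forall>m p q. x = - ((of_nat m / 2)\<^sup>2) \<longrightarrow> m + p + q < n \<longrightarrow>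
        (wilson_A ^^ p) ((wilson_D ^^ q) f) field_differentiable at (- 1 / 4))"

lemma wilson_defined_generic:
  assumes "\<And>m. m < n \<Longrightarrow> x \<noteq> - ((of_nat m / 2)\<^sup>2)"
  shows "wilson_defined n f x"
proof -
  have "x \<noteq> - ((of_nat m / 2)\<^sup>2)" if "m + p + q < n" for m p q :: nat
    using assms[of m] that by simp
  then show ?thesis unfolding wilson_defined_def by blast
qed

lemma square_eq_csqrt: "z\<^sup>2 = x \<Longrightarrow> z = csqrt x \<or> z = - csqrt x"
  by (metis power2_csqrt power2_eq_iff)

lemma wilson_quot_eq:
  assumes "z\<^sup>2 = x"
  shows "wilson_quot f x = (f ((z + \<i> / 2)\<^sup>2) - f ((z - \<i> / 2)\<^sup>2)) / (2 * \<i> * z)"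
proof -
  have "(- w + \<i> / 2)\<^sup>2 = (w - \<i> / 2)\<^sup>2" "(- w - \<i> / 2)\<^sup>2 = (w + \<i> / 2)\<^sup>2" for w :: complex
    by (simp_all add: power2_eq_square algebra_simps)
  then show ?thesis
    using square_eq_csqrt[OF assms] unfolding wilson_quot_def
    by (auto simp: diff_divide_distrib)
qed

lemma wilson_A_eq:
  assumes "z\<^sup>2 = x"
  shows "wilson_A f x = (f ((z + \<i> / 2)\<^sup>2) + f ((z - \<i> / 2)\<^sup>2)) / 2"
proof -
  have "(- w + \<i> / 2)\<^sup>2 = (w - \<i> / 2)\<^sup>2" "(- w - \<i> / 2)\<^sup>2 = (w + \<i> / 2)\<^sup>2" for w :: complex
    by (simp_all add: power2_eq_square algebra_simps)
  then show ?thesis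
    using square_eq_csqrt[OF assms] unfolding wilson_A_def by auto
qed

lemma tendsto_csqrt_0: "(csqrt \<longlongrightarrow> 0) (at 0)"
proof (rule tendsto_norm_zero_cancel)
  have "((\<lambda>x::complex. sqrt (norm x)) \<longlongrightarrow> sqrt (norm (0::complex))) (at 0)"
    by (intro tendsto_intros)
  then show "((\<lambda>x. norm (csqrt x)) \<longlongrightarrow> 0) (at 0)" by simp
qed

lemma tendsto_wilson_quot_0:
  assumes "f field_differentiable at (- 1 / 4)"
  shows "(wilson_quot f \<longlongrightarrow> deriv f (- 1 / 4)) (at 0)"
proof -
  have "(f has_field_derivative deriv f (- 1 / 4)) (at (- 1 / 4))"
    using assms by (simp add: DERIV_deriv_iff_field_differentiable)
  then obtain g where g: "\<And>z. f z - f (- 1 / 4) = g z * (z - (- 1 / 4))"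
      "isCont g (- 1 / 4)" "g (- 1 / 4) = deriv f (- 1 / 4)"
    unfolding CARAT_DERIV by blast
  define u v where "u = (\<lambda>x. (csqrt x + \<i> / 2)\<^sup>2)" and "v = (\<lambda>x. (csqrt x - \<i> / 2)\<^sup>2)"
  have lim: "((\<lambda>x. g (u x)) \<longlongrightarrow> deriv f (- 1 / 4)) (at 0)"
       "((\<lambda>x. g (v x)) \<longlongrightarrow> deriv f (- 1 / 4)) (at 0)"
  proof -
    have "(u \<longlongrightarrow> (0 + \<i> / 2)\<^sup>2) (at 0)" "(v \<longlongrightarrow> (0 - \<i> / 2)\<^sup>2) (at 0)"
      unfolding u_def v_def by (intro tendsto_intros tendsto_csqrt_0)+
    then have "(u \<longlongrightarrow> - 1 / 4) (at 0)" "(v \<longlongrightarrow> - 1 / 4) (at 0)"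
      by (simp_all add: power_divide)
    then show "((\<lambda>x. g (u x)) \<longlongrightarrow> deriv f (- 1 / 4)) (at 0)"
         "((\<lambda>x. g (v x)) \<longlongrightarrow> deriv f (- 1 / 4)) (at 0)"
      using isCont_tendsto_compose[OF g(2)] g(3) by auto
  qed
  have "((\<lambda>x. (g (u x) * (csqrt x + \<i>) - g (v x) * (csqrt x - \<i>)) / (2 * \<i>)) \<longlongrightarrow>
          (deriv f (- 1 / 4) * (0 + \<i>) - deriv f (- 1 / 4) * (0 - \<i>)) / (2 * \<i>)) (at 0)"
    by (intro tendsto_intros lim tendsto_csqrt_0) auto
  moreover have "(g (u x) * (csqrt x + \<i>) - g (v x) * (csqrt x - \<i>)) / (2 * \<i>) = wilson_quot f x"
    if "x \<noteq> 0" for x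
  proof -
    have e: "u x - (- 1 / 4) = csqrt x * (csqrt x + \<i>)" "v x - (- 1 / 4) = csqrt x * (csqrt x - \<i>)"
      unfolding u_def v_def by (simp_all add: power2_eq_square algebra_simps)
    have "f (u x) - f (v x) = (f (u x) - f (- 1 / 4)) - (f (v x) - f (- 1 / 4))" by simp
    also have "\<dots> = csqrt x * (g (u x) * (csqrt x + \<i>) - g (v x) * (csqrt x - \<i>))"
      by (simp only: g(1) e) (simp only: algebra_simps)
    finally have "wilson_quot f x =
        csqrt x * (g (u x) * (csqrt x + \<i>) - g (v x) * (csqrt x - \<i>)) / (2 * \<i> * csqrt x)"
      by (simp only: wilson_quot_def u_def v_def)
    then show ?thesis using that by simp
  qed
  ultimately have "(wilson_quot f \<longlongrightarrow>
      (deriv f (- 1 / 4) * (0 + \<i>) - deriv f (- 1 / 4) * (0 - \<i>)) / (2 * \<i>)) (at 0)"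
    by (elim Lim_transform_eventually) (simp add: eventually_at_filter)
  moreover have "(d * (0 + \<i>) - d * (0 - \<i>)) / (2 * \<i>) = d" for d :: complex
    by (simp add: field_simps)
  ultimately show ?thesis by (simp only:)
qed

lemma wilson_D_0:
  assumes "f field_differentiable at (- 1 / 4)"
  shows "wilson_D f 0 = deriv f (- 1 / 4)"
  unfolding wilson_D_def using tendsto_Lim[OF _ tendsto_wilson_quot_0[OF assms]] by simp

lemma holomorphic_even_csqrt:
  assumes F: "F holomorphic_on - {0}" and even: "\<And>z. F (- z) = F z"
    and h: "\<And>x. x \<noteq> 0 \<Longrightarrow> h x = F (csqrt x)"
  shows "h holomorphic_on - {0}"
proof -
  let ?S = "- \<real>\<^sub>\<le>\<^sub>0 :: complex set" and ?T = "uminus -` (- \<real>\<^sub>\<le>\<^sub>0) :: complex set"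
  have S: "h holomorphic_on ?S"
  proof (rule holomorphic_transform)
    show "(F \<circ> csqrt) holomorphic_on ?S"
      by (rule holomorphic_on_compose_gen[OF holomorphic_on_csqrt F]) auto
    fix x :: complex assume "x \<in> ?S"
    then have "x \<noteq> 0" by auto
    then show "(F \<circ> csqrt) x = h x" by (simp add: h)
  qed
  have T: "h holomorphic_on ?T"
  proof (rule holomorphic_transform)
    have "(\<lambda>x. \<i> * csqrt (- x)) holomorphic_on ?T" by (intro holomorphic_intros) auto
    then show "(F \<circ> (\<lambda>x. \<i> * csqrt (- x))) holomorphic_on ?T"
      by (rule holomorphic_on_compose_gen[OF _ F]) auto
    fix x assume "x \<in> ?T"
    then have "x \<noteq> 0" by auto
    have "(\<i> * csqrt (- x))\<^sup>2 = x" by (simp add: power_mult_distrib)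
    from square_eq_csqrt[OF this] have "F (\<i> * csqrt (- x)) = F (csqrt x)"
      using even by auto
    then show "(F \<circ> (\<lambda>x. \<i> * csqrt (- x))) x = h x" using h[OF \<open>x \<noteq> 0\<close>] by simp
  qed
  have "open ?T" by (intro open_vimage continuous_intros) auto
  then have "h holomorphic_on ?S \<union> ?T"
    by (intro holomorphic_on_Un S T) auto
  moreover have "?S \<union> ?T = - {0}"
    by (auto simp: complex_nonpos_Reals_iff complex_eq_iff)
  ultimately show ?thesis by simp
qed

lemma wilson_A_entire:
  assumes "f holomorphic_on UNIV"
  shows "wilson_A f holomorphic_on UNIV"
proof (rule no_isolated_singularity'[where K = "{0}"])
  let ?F = "\<lambda>z. (f ((z + \<i> / 2)\<^sup>2) + f ((z - \<i> / 2)\<^sup>2)) / 2"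
  have comp: "(\<lambda>z. f (k z)) holomorphic_on UNIV" if "k holomorphic_on UNIV" for k
    using holomorphic_on_compose_gen[OF that assms] by (simp add: o_def)
  have F: "?F holomorphic_on UNIV" by (intro holomorphic_intros comp) auto
  have "wilson_A f holomorphic_on - {0}"
  proof (rule holomorphic_even_csqrt)
    show "?F holomorphic_on - {0}" using F holomorphic_on_subset by blast
    show "?F (- z) = ?F z" for z
      using wilson_A_eq[of "- z" "z\<^sup>2" f] wilson_A_eq[of z "z\<^sup>2" f] by simp
  qed (simp add: wilson_A_def)
  then show "wilson_A f holomorphic_on UNIV - {0}" by (simp add: Compl_eq_Diff_UNIV)
  have "isCont ?F 0"
    using holomorphic_on_imp_continuous_on[OF F] by (simp add: continuous_on_eq_continuous_at)
  from isCont_tendsto_compose[OF this tendsto_csqrt_0]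
  show "(wilson_A f \<longlongrightarrow> wilson_A f z) (at z within UNIV)" if "z \<in> {0}" for z
    using that by (simp add: wilson_A_def[abs_def])
qed auto

lemma wilson_D_entire:
  assumes "f holomorphic_on UNIV"
  shows "wilson_D f holomorphic_on UNIV"
proof (rule no_isolated_singularity'[where K = "{0}"])
  let ?F = "\<lambda>z. (f ((z + \<i> / 2)\<^sup>2) - f ((z - \<i> / 2)\<^sup>2)) / (2 * \<i> * z)"
  have comp: "(\<lambda>z. f (k z)) holomorphic_on - {0}" if "k holomorphic_on - {0}" for k
    using holomorphic_on_compose_gen[OF that assms] by (simp add: o_def)
  have "wilson_D f holomorphic_on - {0}"
  proof (rule holomorphic_even_csqrt)
    show "?F holomorphic_on - {0}" by (intro holomorphic_intros comp) auto
    show "?F (- z) = ?F z" for z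
      using wilson_quot_eq[of "- z" "z\<^sup>2" f] wilson_quot_eq[of z "z\<^sup>2" f] by simp
  qed (simp add: wilson_D_def wilson_quot_def)
  then show "wilson_D f holomorphic_on UNIV - {0}" by (simp add: Compl_eq_Diff_UNIV)
  have "f field_differentiable at (- 1 / 4)"
    using assms by (auto intro: holomorphic_on_imp_differentiable_at)
  note d = tendsto_wilson_quot_0[OF this] wilson_D_0[OF this]
  have "(wilson_D f \<longlongrightarrow> deriv f (- 1 / 4)) (at 0)"
    using d(1) by (rule Lim_transform_eventually)
      (auto simp: wilson_D_def eventually_at_filter)
  then show "(wilson_D f \<longlongrightarrow> wilson_D f z) (at z within UNIV)" if "z \<in> {0}" for z
    using that d(2) by simp
qed auto

lemma wilson_defined_entire:
  assumes "f holomorphic_on UNIV"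
  shows "wilson_defined n f x"
proof -
  have D: "(wilson_D ^^ q) f holomorphic_on UNIV" for q
    by (induction q) (auto intro: assms wilson_D_entire)
  have "(wilson_A ^^ p) ((wilson_D ^^ q) f) holomorphic_on UNIV" for p q
    by (induction p) (auto intro: D wilson_A_entire)
  then show ?thesis
    unfolding wilson_defined_def by (meson UNIV_I holomorphic_on_imp_differentiable_at open_UNIV)
qed

end

theory Submission
  imports Defs
begin

text \<open>
  Write \<open>D\<close> and \<open>A\<close> for the two operators. Two identities carry the whole proof: the product
  rule \<open>D (f g) = D f \<cdot> A g + A f \<cdot> D g\<close> (lemma \<open>wilson_D_mult\<close>) and the commutation rule
  \<open>D A = A D - D\<^sup>2 / 2\<close> (lemma \<open>wilson_D_A\<close>), which iterates to
  \<open>D\<^sup>q A = A D\<^sup>q - (q / 2) D\<^sup>q\<^sup>+\<^sup>1\<close> (lemma \<open>power_D_A\<close>).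

  Splitting off the innermost \<open>D\<close> gives
  \<open>D\<^sup>n\<^sup>+\<^sup>1 (f g) = D\<^sup>n (D f \<cdot> A g) + D\<^sup>n (A f \<cdot> D g)\<close>, and the formula for \<open>n\<close> applies to both
  products. The extra \<open>A\<close> stands to the right of a power of \<open>D\<close>; moving it to the left produces
  the wanted terms with the same \<open>k\<close>, which combine by Pascal's rule, and correction terms with
  factors \<open>(j + k) / 2\<close> and \<open>(n - j) / 2\<close>. In the summand \<open>j\<close> both corrections belong to the same
  term, of index \<open>k + 1\<close>, and the sum of the two factors, \<open>(n + k) / 2\<close>, does not depend on
  \<open>j\<close>. So the formula for \<open>n + 1\<close> amounts to
  \<open>C(n+1, k+1) = C(n, k+1) - (n + k) / 2 \<cdot> C(n, k)\<close> (lemma \<open>wilson_C_Suc\<close>). Splitting off the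
  outermost \<open>D\<close> instead would require the longer formula for \<open>D A\<^sup>p\<close>.

  The analytic work concerns the points from which the iteration reaches \<open>0\<close>, where \<open>D\<close> is a
  limit. There the product rule, the commutation rule and even the additivity of \<open>D\<close> need
  differentiability at \<open>-1/4\<close>. The predicate \<open>admissible\<close> records which orders of
  differentiability are available at a point, and congruence rules transport identities that hold
  at the admissible points through further applications of \<open>A\<close> and \<open>D\<close>. Additivity is the
  delicate case: it requires \<open>D\<^sup>r (D f \<cdot> A g)\<close> to be differentiable at \<open>-1/4\<close>, and this is
  obtained by a separate induction (lemma \<open>power_D_mult_differentiable\<close>).
\<close>
section \<open>Values at the two shifted points\<close>

text \<open>
  Solving the definitions of the two operators for the shifted values gives a form without
  division. At \<open>w = 0\<close> the shifted points coincide and the limit value of \<open>wilson_D\<close> is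
  multiplied by \<open>0\<close>, so it holds there for every \<open>f\<close>.
\<close>
lemma shifted_values:
  "f ((w + \<i> / 2)\<^sup>2) = wilson_A f (w\<^sup>2) + \<i> * w * wilson_D f (w\<^sup>2)"
  "f ((w - \<i> / 2)\<^sup>2) = wilson_A f (w\<^sup>2) - \<i> * w * wilson_D f (w\<^sup>2)"
proof -
  have A: "wilson_A f (w\<^sup>2) = (f ((w + \<i> / 2)\<^sup>2) + f ((w - \<i> / 2)\<^sup>2)) / 2"
    by (rule wilson_A_eq) simp
  have D: "\<i> * w * wilson_D f (w\<^sup>2) = (f ((w + \<i> / 2)\<^sup>2) - f ((w - \<i> / 2)\<^sup>2)) / 2"
  proof (cases "w = 0")
    case False
    then show ?thesis
      using wilson_quot_eq[OF refl, of f w] by (simp add: wilson_D_def)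
  qed simp
  show "f ((w + \<i> / 2)\<^sup>2) = wilson_A f (w\<^sup>2) + \<i> * w * wilson_D f (w\<^sup>2)"
    "f ((w - \<i> / 2)\<^sup>2) = wilson_A f (w\<^sup>2) - \<i> * w * wilson_D f (w\<^sup>2)"
    unfolding A D by (simp_all add: field_simps)
qed

lemma wilson_D_nonzero:
  assumes "z \<noteq> 0"
  shows "wilson_D f (z\<^sup>2) = (f ((z + \<i> / 2)\<^sup>2) - f ((z - \<i> / 2)\<^sup>2)) / (2 * \<i> * z)"
  using assms wilson_quot_eq[OF refl, of f z] by (simp add: wilson_D_def)

lemma square_root_cases:
  fixes x :: complex
  assumes "x \<noteq> 0"
  obtains z where "z \<noteq> 0" "x = z\<^sup>2"
  using assms that[of "csqrt x"] by simp

section \<open>One-step rules\<close>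

text \<open>
  Away from \<open>0\<close> this is the identity
  \<open>2 (F G - F' G') = (F - F') (G + G') + (F + F') (G - G')\<close> for the shifted values; at \<open>0\<close> it is
  the product rule for the derivative at \<open>-1/4\<close>.
\<close>
lemma wilson_D_mult:
  assumes "x = 0 \<Longrightarrow> f field_differentiable at (- 1 / 4) \<and> g field_differentiable at (- 1 / 4)"
  shows "wilson_D (\<lambda>y. f y * g y) x
    = wilson_D f x * wilson_A g x + wilson_A f x * wilson_D g x"
proof (cases "x = 0")
  case True
  with assms have d: "f field_differentiable at (- 1 / 4)" "g field_differentiable at (- 1 / 4)"
    by auto
  have "wilson_A h 0 = h (- 1 / 4)" for h
    by (simp add: wilson_A_def power_divide)
  then show ?thesis
    using d by (simp add: True wilson_D_0 field_differentiable_mult)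
next
  case False
  then obtain z where z: "z \<noteq> 0" "x = z\<^sup>2" by (rule square_root_cases)
  show ?thesis
    unfolding z(2) using z(1)
    by (subst wilson_D_nonzero, assumption, unfold shifted_values) (simp add: field_simps)
qed

lemma wilson_D_add:
  assumes "x = 0 \<Longrightarrow> f field_differentiable at (- 1 / 4) \<and> g field_differentiable at (- 1 / 4)"
  shows "wilson_D (\<lambda>y. f y + g y) x = wilson_D f x + wilson_D g x"
proof (cases "x = 0")
  case True
  with assms show ?thesis by (simp add: wilson_D_0 field_differentiable_add)
next
  case False
  then show ?thesis by (simp add: wilson_D_def wilson_quot_def diff_divide_distrib add_divide_distrib)
qed

lemma wilson_D_cmult:
  assumes "x = 0 \<Longrightarrow> f field_differentiable at (- 1 / 4)"
  shows "wilson_D (\<lambda>y. c * f y) x = c * wilson_D f x"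
proof (cases "x = 0")
  case True
  with assms show ?thesis
    by (simp add: wilson_D_0 field_differentiable_mult field_differentiable_const)
next
  case False
  then show ?thesis by (simp add: wilson_D_def wilson_quot_def right_diff_distrib)
qed

lemma deriv_even_zero:
  fixes h :: "complex \<Rightarrow> complex"
  assumes h: "(h has_field_derivative c) (at 0)" and even: "\<And>w. h (- w) = h w"
  shows "c = 0"
proof -
  have "((\<lambda>w. h (- w)) has_field_derivative c * (- 1)) (at 0)"
    using h by (intro DERIV_chain2[where f = h] DERIV_minus[OF DERIV_ident]) simp
  then have "c * (- 1) = c"
    using DERIV_unique h unfolding even by blast
  then show ?thesis by simp
qed

text \<open>
  Away from \<open>0\<close> both sides are combinations of the values of \<open>f\<close> at \<open>(z + \<i>)\<^sup>2\<close>, \<open>z\<^sup>2\<close> and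
  \<open>(z - \<i>)\<^sup>2\<close>. At \<open>0\<close> the claim relates the derivatives of \<open>wilson_A f\<close> and \<open>wilson_D f\<close> at
  \<open>-1/4\<close>. It follows because \<open>f (w\<^sup>2)\<close>, expressed through these two functions at
  \<open>(w + \<i> / 2)\<^sup>2\<close>, is an even function of \<open>w\<close>, so its derivative at \<open>w = 0\<close> vanishes.
\<close>
lemma wilson_D_A:
  assumes "x = 0 \<Longrightarrow> wilson_A f field_differentiable at (- 1 / 4)
    \<and> wilson_D f field_differentiable at (- 1 / 4)"
  shows "wilson_D (wilson_A f) x = wilson_A (wilson_D f) x - wilson_D (wilson_D f) x / 2"
proof (cases "x = 0")
  case True
  with assms have
    A: "wilson_A f field_differentiable at (- 1 / 4)" and
    D: "wilson_D f field_differentiable at (- 1 / 4)" by auto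
  define a d where "a = deriv (wilson_A f) (- 1 / 4)" and "d = deriv (wilson_D f) (- 1 / 4)"
  have sq: "(0 + \<i> / 2)\<^sup>2 = - 1 / 4" by (simp add: power_divide)
  have A': "(wilson_A f has_field_derivative a) (at ((0 + \<i> / 2)\<^sup>2))"
    and D': "(wilson_D f has_field_derivative d) (at ((0 + \<i> / 2)\<^sup>2))"
    using A D unfolding sq a_def d_def by (simp_all add: DERIV_deriv_iff_field_differentiable)
  have s: "((\<lambda>w. (w + \<i> / 2)\<^sup>2) has_field_derivative \<i>) (at 0)"
    by (auto intro!: derivative_eq_intros)
  have "((\<lambda>w. wilson_A f ((w + \<i> / 2)\<^sup>2) - \<i> * (w + \<i> / 2) * wilson_D f ((w + \<i> / 2)\<^sup>2))
      has_field_derivative a * \<i> - (\<i> * wilson_D f ((0 + \<i> / 2)\<^sup>2)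
        + d * \<i> * (\<i> * (0 + \<i> / 2)))) (at 0)"
    by (rule derivative_eq_intros DERIV_chain2[OF A' s] DERIV_chain2[OF D' s] refl)+ simp
  also have "(\<lambda>w. wilson_A f ((w + \<i> / 2)\<^sup>2) - \<i> * (w + \<i> / 2) * wilson_D f ((w + \<i> / 2)\<^sup>2))
      = (\<lambda>w. f (w\<^sup>2))"
    by (simp add: shifted_values(2)[symmetric])
  finally have "a * \<i> - (\<i> * wilson_D f ((0 + \<i> / 2)\<^sup>2) + d * \<i> * (\<i> * (0 + \<i> / 2))) = 0"
    by (rule deriv_even_zero) simp
  then have "\<i> * (a - (wilson_D f (- 1 / 4) - d / 2)) = 0"
    unfolding sq by (simp add: algebra_simps)
  then have "a = wilson_D f (- 1 / 4) - d / 2" by simp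
  moreover have "wilson_A (wilson_D f) 0 = wilson_D f (- 1 / 4)"
    by (simp add: wilson_A_def power_divide)
  ultimately show ?thesis
    using A D by (simp add: True wilson_D_0 a_def d_def)
next
  case False
  then obtain z where z: "z \<noteq> 0" "x = z\<^sup>2" by (rule square_root_cases)
  \<comment> \<open>Keeping \<open>p\<close> and \<open>m\<close> opaque covers the case that a shifted point is \<open>0\<close>, where one of them is
    a limit.\<close>
  define p m where "p = wilson_D f ((z + \<i> / 2)\<^sup>2)" and "m = wilson_D f ((z - \<i> / 2)\<^sup>2)"
  have c: "f (z\<^sup>2) = wilson_A f ((z + \<i> / 2)\<^sup>2) - \<i> * (z + \<i> / 2) * p"
          "f (z\<^sup>2) = wilson_A f ((z - \<i> / 2)\<^sup>2) + \<i> * (z - \<i> / 2) * m"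
    using shifted_values(2)[of f "z + \<i> / 2"] shifted_values(1)[of f "z - \<i> / 2"]
    by (simp_all add: p_def m_def)
  have "wilson_D (wilson_A f) x = (\<i> * (z + \<i> / 2) * p + \<i> * (z - \<i> / 2) * m) / (2 * \<i> * z)"
    unfolding z(2) wilson_D_nonzero[OF z(1)] using c by (simp add: algebra_simps)
  moreover have "wilson_A (wilson_D f) x = (p + m) / 2"
    unfolding z(2) p_def m_def by (rule wilson_A_eq) simp
  moreover have "wilson_D (wilson_D f) x = (p - m) / (2 * \<i> * z)"
    unfolding z(2) p_def m_def by (rule wilson_D_nonzero[OF z(1)])
  moreover have "(\<i> * (z + \<i> / 2) * p + \<i> * (z - \<i> / 2) * m) / (2 * \<i> * z)
      = (p + m) / 2 - (p - m) / (2 * \<i> * z) / 2"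
    using z(1) by (simp add: field_simps)
  ultimately show ?thesis by (simp only:)
qed

section \<open>Propagation through exceptional points\<close>

text \<open>
  \<open>P r\<close> stands for a property of order \<open>r\<close> at \<open>-1/4\<close>. From \<open>-(m/2)\<^sup>2\<close> the point \<open>0\<close> is reached in
  \<open>m\<close> steps at the earliest; of \<open>n\<close> operators, one is then applied at \<open>0\<close> itself to a function
  that arises by at most \<open>n - m - 1\<close> operators. Hence only orders \<open>r < n - m\<close> are demanded, and
  nothing at points of another form.
\<close>
definition admissible :: "(nat \<Rightarrow> bool) \<Rightarrow> nat \<Rightarrow> complex \<Rightarrow> bool" where
  "admissible P n x \<longleftrightarrow> (\<forall>m r. x = - ((of_nat m / 2)\<^sup>2) \<longrightarrow> m + r < n \<longrightarrow> P r)"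

text \<open>
  Lowering the number of operators by \<open>d\<close> allows properties of order \<open>r\<close> to be derived from
  properties of order up to \<open>r + d\<close>.
\<close>
lemma admissible_lower:
  assumes "admissible P n x" "k \<le> n" "\<And>r. r < k \<Longrightarrow> (\<And>s. s \<le> r + (n - k) \<Longrightarrow> P s) \<Longrightarrow> Q r"
  shows "admissible Q k x"
  unfolding admissible_def
proof (intro allI impI)
  fix m r assume x: "x = - ((of_nat m / 2)\<^sup>2)" and "m + r < k"
  then have "r < k" "P s" if "s \<le> r + (n - k)" for s
    using assms(1,2) that unfolding admissible_def by auto
  then show "Q r" using assms(3) by blast
qed

lemma admissible_0: "admissible P n 0 \<Longrightarrow> r < n \<Longrightarrow> P r"
  unfolding admissible_def by (drule spec[of _ 0]) auto

lemma admissible_quarter: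
  "admissible P n (- 1 / 4) \<longleftrightarrow> (\<forall>r. Suc r < n \<longrightarrow> P r)"
proof -
  have "- 1 / 4 = - ((of_nat m / 2)\<^sup>2 :: complex) \<longleftrightarrow> m = 1" for m
  proof
    assume "- 1 / 4 = - ((of_nat m / 2)\<^sup>2 :: complex)"
    then have "of_nat (m\<^sup>2) = (of_nat 1 :: complex)" by (simp add: field_simps)
    then have "m\<^sup>2 = 1" by (subst (asm) of_nat_eq_iff)
    then show "m = 1" by simp
  qed (simp add: power_divide)
  then show ?thesis unfolding admissible_def by auto
qed

text \<open>
  Moving to a neighbouring point changes \<open>m\<close> by one, or takes \<open>m = 0\<close> to \<open>1\<close>, so a point with
  parameter \<open>m\<close> is only reached from one with parameter at most \<open>m + 1\<close>; the additional operator
  pays for the difference.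
\<close>
lemma admissible_shift:
  assumes "admissible P (Suc n) (z\<^sup>2)"
  shows "admissible P n ((z + \<i> / 2)\<^sup>2)" "admissible P n ((z - \<i> / 2)\<^sup>2)"
proof -
  have *: "admissible P n ((z + \<i> / 2)\<^sup>2)" if "admissible P (Suc n) (z\<^sup>2)" for z
    unfolding admissible_def
  proof (intro allI impI)
    fix m r assume "(z + \<i> / 2)\<^sup>2 = - ((of_nat m / 2)\<^sup>2)" and le: "m + r < n"
    then have "(z + \<i> / 2)\<^sup>2 = (\<i> * of_nat m / 2)\<^sup>2" by (simp add: power_mult_distrib power_divide)
    then have "z = \<i> * of_nat m / 2 - \<i> / 2 \<or> z = - (\<i> * of_nat m / 2) - \<i> / 2"
      by (simp only: power2_eq_iff eq_diff_eq)
    also have "\<i> * of_nat m / 2 - \<i> / 2 = \<i> / 2 * (of_nat m - 1)"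
      by (simp add: field_simps)
    also have "- (\<i> * of_nat m / 2) - \<i> / 2 = - (\<i> / 2 * of_nat (m + 1))"
      by (simp add: field_simps)
    finally consider "z = \<i> / 2 * (of_nat m - 1)" | "z = - (\<i> / 2 * of_nat (m + 1))"
      by blast
    then obtain l where "z\<^sup>2 = - ((of_nat l / 2)\<^sup>2)" "l \<le> Suc m"
    proof cases
      case 1
      show thesis
      proof (cases m)
        case 0
        with 1 show thesis by (intro that[of 1]) (auto simp: power_divide)
      next
        case (Suc l)
        have "z = \<i> * (of_nat l / 2)" using 1 by (simp add: Suc)
        then have "z\<^sup>2 = - ((of_nat l / 2)\<^sup>2)" by (simp only: power_mult_distrib) simp
        then show thesis by (rule that) (simp add: Suc)
      qed
    next
      case 2
      show thesis
        by (intro that[of "m + 1"]) (unfold 2, auto simp: power_mult_distrib power_divide)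
    qed
    with that le show "P r" unfolding admissible_def by auto
  qed
  show "admissible P n ((z + \<i> / 2)\<^sup>2)" using *[OF assms] .
  have "(- z + \<i> / 2)\<^sup>2 = (z - \<i> / 2)\<^sup>2" by (simp add: power2_eq_square algebra_simps)
  with *[of "- z"] assms show "admissible P n ((z - \<i> / 2)\<^sup>2)" by simp
qed

text \<open>
  Only finitely many points carry a condition, hence none in a small punctured neighbourhood.
\<close>
lemma eventually_admissible: "eventually (admissible P n) (at a)"
proof -
  let ?E = "(\<lambda>m. - ((of_nat m / 2)\<^sup>2) :: complex) ` {..<n}"
  have "eventually (\<lambda>y. y \<in> - (?E - {a})) (nhds a)"
    by (intro eventually_nhds_in_open open_Compl finite_imp_closed) auto
  then have "eventually (\<lambda>y. y \<notin> ?E) (at a)"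
    unfolding eventually_at_filter by eventually_elim auto
  then show ?thesis
    by eventually_elim (auto simp: admissible_def)
qed

lemma wilson_A_cong:
  assumes "\<And>y. admissible P n y \<Longrightarrow> u y = v y" and "admissible P (Suc n) x"
  shows "wilson_A u x = wilson_A v x"
  using admissible_shift[of P n "csqrt x"] assms by (simp add: wilson_A_def)

lemma power_A_cong:
  assumes "\<And>y. admissible P n y \<Longrightarrow> u y = v y" and "admissible P (n + p) x"
  shows "(wilson_A ^^ p) u x = (wilson_A ^^ p) v x"
  using assms(2)
proof (induction p arbitrary: x)
  case (Suc p)
  then show ?case by (auto intro: wilson_A_cong[of P "n + p"])
qed (use assms(1) in simp)

text \<open>
  Near \<open>0\<close>, the two shifted points approach \<open>-1/4\<close> without attaining it: \<open>(w + c)\<^sup>2 = c\<^sup>2\<close> only for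
  \<open>w = 0\<close> and \<open>w = -2 c\<close>. Therefore punctured neighbourhoods of \<open>-1/4\<close> decide the limit that
  defines \<open>wilson_D\<close> at \<open>0\<close>.
\<close>
lemma eventually_shift:
  assumes "eventually Q (at (- 1 / 4))"
  shows "\<forall>\<^sub>F x in at 0. Q ((csqrt x + \<i> / 2)\<^sup>2)" "\<forall>\<^sub>F x in at 0. Q ((csqrt x - \<i> / 2)\<^sup>2)"
proof -
  have *: "\<forall>\<^sub>F x in at 0. Q ((csqrt x + c)\<^sup>2)" if c: "c\<^sup>2 = - 1 / 4" for c
  proof -
    have "((\<lambda>x. (csqrt x + c)\<^sup>2) \<longlongrightarrow> (0 + c)\<^sup>2) (at 0)"
      by (intro tendsto_intros tendsto_csqrt_0)
    moreover have "\<forall>\<^sub>F x in at 0. (csqrt x + c)\<^sup>2 \<noteq> - 1 / 4"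
    proof -
      have "c \<noteq> 0" using c by auto
      have "\<forall>\<^sub>F x in at 0. csqrt x \<noteq> - 2 * c"
        using \<open>c \<noteq> 0\<close> by (intro tendsto_imp_eventually_ne[OF tendsto_csqrt_0]) simp
      moreover have "\<forall>\<^sub>F x in at 0. x \<noteq> (0::complex)" by (simp add: eventually_at_filter)
      ultimately show ?thesis
      proof eventually_elim
        case (elim x)
        have "(csqrt x + c)\<^sup>2 - c\<^sup>2 = csqrt x * (csqrt x - (- 2 * c))"
          by (simp add: power2_eq_square algebra_simps)
        moreover have "csqrt x * (csqrt x - (- 2 * c)) \<noteq> 0"
          using elim by (simp only: mult_eq_0_iff right_minus_eq csqrt_eq_0) simp
        ultimately show ?case using c by (metis right_minus_eq)
      qed
    qed
    ultimately have "filterlim (\<lambda>x. (csqrt x + c)\<^sup>2) (at (- 1 / 4)) (at 0)"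
      by (simp add: filterlim_at c)
    then show ?thesis using assms by (simp add: filterlim_iff)
  qed
  show "\<forall>\<^sub>F x in at 0. Q ((csqrt x + \<i> / 2)\<^sup>2)" by (rule *) (simp add: power_divide)
  show "\<forall>\<^sub>F x in at 0. Q ((csqrt x - \<i> / 2)\<^sup>2)"
    using *[of "- (\<i> / 2)"] by (simp add: power_divide)
qed

text \<open>
  At \<open>0\<close> the two quotients agree in a punctured neighbourhood, which determines the value of
  \<^term>\<open>Lim\<close> even where the limit does not exist.
\<close>
lemma wilson_D_cong:
  assumes "\<And>y. admissible P n y \<Longrightarrow> u y = v y" and "admissible P (Suc n) x"
  shows "wilson_D u x = wilson_D v x"
proof (cases "x = 0")
  case True
  have "\<forall>\<^sub>F x in at 0. wilson_quot u x = wilson_quot v x"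
    using eventually_shift[OF eventually_admissible[of P n]]
    by eventually_elim (simp add: wilson_quot_def assms(1))
  then have "(wilson_quot u \<longlongrightarrow> l) (at 0) \<longleftrightarrow> (wilson_quot v \<longlongrightarrow> l) (at 0)" for l
    by (rule filterlim_cong[OF refl refl])
  then show ?thesis by (simp add: True wilson_D_def Topological_Spaces.Lim_def)
next
  case False
  then show ?thesis
    using admissible_shift[of P n "csqrt x"] assms by (simp add: wilson_D_def wilson_quot_def)
qed

lemma power_D_cong:
  assumes "\<And>y. admissible P n y \<Longrightarrow> u y = v y" and "admissible P (n + q) x"
  shows "(wilson_D ^^ q) u x = (wilson_D ^^ q) v x"
  using assms(2)
proof (induction q arbitrary: x)
  case (Suc q)
  then show ?case by (auto intro: wilson_D_cong[of P "n + q"])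
qed (use assms(1) in simp)

text \<open>
  Since \<open>-1/4\<close> is the point with \<open>m = 1\<close>, its admissibility costs one order; then all points of
  a full neighbourhood are admissible.
\<close>
lemma field_differentiable_cong_admissible:
  assumes "\<And>y. admissible P n y \<Longrightarrow> u y = v y" and "\<And>r. Suc r < n \<Longrightarrow> P r"
    and "v field_differentiable at (- 1 / 4)"
  shows "u field_differentiable at (- 1 / 4)"
proof -
  have "admissible P n (- 1 / 4)"
    using assms(2) unfolding admissible_quarter by blast
  with eventually_admissible[of P n "- 1 / 4"]
  have "eventually (admissible P n) (nhds (- 1 / 4))"
    unfolding eventually_nhds_conv_at by blast
  then have "\<forall>\<^sub>F y in nhds (- 1 / 4). u y = v y"
    by eventually_elim (rule assms(1))
  moreover obtain d where "(v has_field_derivative d) (at (- 1 / 4))"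
    using assms(3) unfolding field_differentiable_def by blast
  ultimately have "(u has_field_derivative d) (at (- 1 / 4))"
    using DERIV_cong_ev[OF refl _ refl] by blast
  then show ?thesis unfolding field_differentiable_def by blast
qed

section \<open>Moving an averaging operator to the left\<close>

definition differentiable_of_order :: "(complex \<Rightarrow> complex) \<Rightarrow> nat \<Rightarrow> bool" where
  "differentiable_of_order f r \<longleftrightarrow> (\<forall>p q. p + q = r \<longrightarrow>
     (wilson_A ^^ p) ((wilson_D ^^ q) f) field_differentiable at (- 1 / 4))"

lemma wilson_defined_iff_admissible:
  "wilson_defined n f x \<longleftrightarrow> admissible (differentiable_of_order f) n x"
  unfolding wilson_defined_def admissible_def differentiable_of_order_def add.assoc
proof (intro iffI allI impI, goal_cases)
  case (1 m r p q)
  then show ?case by (elim allE[of _ m] allE[of _ p] allE[of _ q]) simp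
next
  case (2 m p q)
  then show ?case by (elim allE[of _ m] allE[of _ "p + q"]) simp
qed

lemma differentiable_of_orderD:
  "differentiable_of_order f (p + q) \<Longrightarrow>
    (wilson_A ^^ p) ((wilson_D ^^ q) f) field_differentiable at (- 1 / 4)"
  by (simp add: differentiable_of_order_def)

text \<open>
  By induction on \<open>q\<close>: \<open>D (A D\<^sup>q - (q / 2) D\<^sup>q\<^sup>+\<^sup>1) = (A D - D\<^sup>2 / 2) D\<^sup>q - (q / 2) D\<^sup>q\<^sup>+\<^sup>2\<close>, where each
  step adds \<open>1/2\<close> to the coefficient.
\<close>
lemma power_D_A:
  assumes "admissible (differentiable_of_order f) (Suc q) x"
  shows "(wilson_D ^^ q) (wilson_A f) x
    = wilson_A ((wilson_D ^^ q) f) x - of_nat q / 2 * (wilson_D ^^ Suc q) f x"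
  using assms
proof (induction q arbitrary: x)
  case (Suc q)
  have diff: "(wilson_A ^^ i) ((wilson_D ^^ j) f) field_differentiable at (- 1 / 4)"
    if "x = 0" "i + j < Suc (Suc q)" for i j
    using Suc.prems that by (intro differentiable_of_orderD) (auto elim: admissible_0)
  have "(wilson_D ^^ Suc q) (wilson_A f) x
      = wilson_D (\<lambda>y. wilson_A ((wilson_D ^^ q) f) y
          + - (of_nat q / 2) * (wilson_D ^^ Suc q) f y) x"
    using wilson_D_cong[OF Suc.IH Suc.prems] by simp
  also have "\<dots> = wilson_D (wilson_A ((wilson_D ^^ q) f)) x
      + wilson_D (\<lambda>y. - (of_nat q / 2) * (wilson_D ^^ Suc q) f y) x"
    using diff[of 1 q] diff[of 0 "Suc q"]
    by (intro wilson_D_add conjI field_differentiable_mult field_differentiable_const) auto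
  also have "wilson_D (\<lambda>y. - (of_nat q / 2) * (wilson_D ^^ Suc q) f y) x
      = - (of_nat q / 2) * wilson_D ((wilson_D ^^ Suc q) f) x"
    using diff[of 0 "Suc q"] by (intro wilson_D_cmult) auto
  also have "wilson_D (wilson_A ((wilson_D ^^ q) f)) x
      = wilson_A ((wilson_D ^^ Suc q) f) x - wilson_D ((wilson_D ^^ Suc q) f) x / 2"
    using diff[of 1 q] diff[of 0 "Suc q"] by (subst wilson_D_A) auto
  finally show ?case by (simp add: add_divide_distrib distrib_right)
qed simp

lemma wilson_A_diff:
  "wilson_A (\<lambda>y. u y - c * v y) x = wilson_A u x - c * wilson_A v x"
  by (simp add: wilson_A_def field_simps)

lemma power_A_diff:
  "(wilson_A ^^ p) (\<lambda>y. u y - c * v y) x = (wilson_A ^^ p) u x - c * (wilson_A ^^ p) v x"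
proof (induction p arbitrary: x)
  case (Suc p)
  show ?case by (simp add: Suc[abs_def] wilson_A_diff)
qed simp

lemma power_A_D_A:
  assumes "admissible (differentiable_of_order f) (Suc (p + q)) x"
  shows "(wilson_A ^^ p) ((wilson_D ^^ q) (wilson_A f)) x
    = (wilson_A ^^ Suc p) ((wilson_D ^^ q) f) x
      - of_nat q / 2 * (wilson_A ^^ p) ((wilson_D ^^ Suc q) f) x"
proof -
  have "(wilson_A ^^ p) ((wilson_D ^^ q) (wilson_A f)) x
      = (wilson_A ^^ p) (\<lambda>y. wilson_A ((wilson_D ^^ q) f) y
          - of_nat q / 2 * (wilson_D ^^ Suc q) f y) x"
    using power_D_A assms by (intro power_A_cong[of _ "Suc q"]) (auto simp: add_ac)
  then show ?thesis by (simp only: power_A_diff funpow_Suc_right comp_apply)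
qed

text \<open>
  Moving the inner \<open>A\<close> to the left expresses \<open>A\<^sup>p D\<^sup>q A f\<close> near \<open>-1/4\<close> by compositions
  \<open>A\<^sup>p' D\<^sup>q' f\<close>, so the conditions on \<open>f\<close> alone, in this ordered form, control \<open>A f\<close>.
\<close>
lemma differentiable_of_order_A:
  assumes "\<And>s. s \<le> Suc r \<Longrightarrow> differentiable_of_order f s"
  shows "differentiable_of_order (wilson_A f) r"
  unfolding differentiable_of_order_def
proof (intro allI impI)
  fix p q assume pq: "p + q = r"
  have "(\<lambda>x. (wilson_A ^^ Suc p) ((wilson_D ^^ q) f) x
      - of_nat q / 2 * (wilson_A ^^ p) ((wilson_D ^^ Suc q) f) x)
      field_differentiable at (- 1 / 4)"
    using pq by (intro field_differentiable_diff field_differentiable_mult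
        field_differentiable_const differentiable_of_orderD assms) auto
  then show "(wilson_A ^^ p) ((wilson_D ^^ q) (wilson_A f)) field_differentiable at (- 1 / 4)"
  proof (rule field_differentiable_cong_admissible[rotated 2])
    show "differentiable_of_order f s" if "Suc s < Suc (p + q)" for s
      using assms that pq by simp
  qed (rule power_A_D_A)
qed

lemma differentiable_of_order_D:
  assumes "differentiable_of_order f (Suc r)"
  shows "differentiable_of_order (wilson_D f) r"
  unfolding differentiable_of_order_def
proof (intro allI impI)
  fix p q assume "p + q = r"
  then show "(wilson_A ^^ p) ((wilson_D ^^ q) (wilson_D f)) field_differentiable at (- 1 / 4)"
    using differentiable_of_orderD[of f p "Suc q"] assms by (simp add: funpow_swap1)
qed

lemma admissible_A:
  assumes "admissible (differentiable_of_order f) (Suc n) x"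
  shows "admissible (differentiable_of_order (wilson_A f)) n x"
  by (rule admissible_lower[OF assms]) (simp_all add: differentiable_of_order_A)

lemma admissible_D:
  assumes "admissible (differentiable_of_order f) (Suc n) x"
  shows "admissible (differentiable_of_order (wilson_D f)) n x"
  by (rule admissible_lower[OF assms]) (simp_all add: differentiable_of_order_D)

section \<open>Powers of the Wilson operator on a product\<close>

lemma power_D_add:
  assumes "admissible (\<lambda>r. (wilson_D ^^ r) u field_differentiable at (- 1 / 4)
    \<and> (wilson_D ^^ r) v field_differentiable at (- 1 / 4)) n x"
  shows "(wilson_D ^^ n) (\<lambda>y. u y + v y) x = (wilson_D ^^ n) u x + (wilson_D ^^ n) v x"
  using assms
proof (induction n arbitrary: x)
  case (Suc n)
  have "(wilson_D ^^ Suc n) (\<lambda>y. u y + v y) x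
      = wilson_D (\<lambda>y. (wilson_D ^^ n) u y + (wilson_D ^^ n) v y) x"
    using wilson_D_cong[OF Suc.IH Suc.prems] by simp
  also have "\<dots> = wilson_D ((wilson_D ^^ n) u) x + wilson_D ((wilson_D ^^ n) v) x"
    using Suc.prems by (intro wilson_D_add) (auto dest: admissible_0[where r = n])
  finally show ?case by simp
qed simp

definition differentiable_pair :: "(complex \<Rightarrow> complex) \<Rightarrow> (complex \<Rightarrow> complex) \<Rightarrow> nat \<Rightarrow> bool" where
  "differentiable_pair f g r \<longleftrightarrow> differentiable_of_order f r \<and> differentiable_of_order g r"

lemma admissible_pair:
  "admissible (differentiable_pair f g) n x \<longleftrightarrow>
    admissible (differentiable_of_order f) n x \<and> admissible (differentiable_of_order g) n x"
  unfolding admissible_def differentiable_pair_def by blast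

lemma differentiable_pair_step:
  assumes "\<And>s. s \<le> Suc r \<Longrightarrow> differentiable_pair f g s"
  shows "differentiable_pair (wilson_D f) (wilson_A g) r"
    "differentiable_pair (wilson_A f) (wilson_D g) r"
  using assms differentiable_of_order_A[of r f] differentiable_of_order_A[of r g]
    differentiable_of_order_D[of f r] differentiable_of_order_D[of g r]
  by (simp_all add: differentiable_pair_def)

text \<open>
  The product rule is applied under \<open>D\<^sup>n\<close>, and then \<open>D\<^sup>n\<close> is distributed over the sum. The latter
  uses differentiability of lower powers of \<open>D\<close> on products, which is an assumption here because
  its proof in turn uses this splitting for smaller \<open>n\<close>.
\<close>
lemma power_D_Suc_mult_if_differentiable:
  assumes "admissible (differentiable_pair f g) (Suc n) x"
    and diff: "\<And>r f g. r < n \<Longrightarrow> (\<And>s. s \<le> r \<Longrightarrow> differentiable_pair f g s) \<Longrightarrow>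
      (wilson_D ^^ r) (\<lambda>y. f y * g y) field_differentiable at (- 1 / 4)"
  shows "(wilson_D ^^ Suc n) (\<lambda>y. f y * g y) x
    = (wilson_D ^^ n) (\<lambda>y. wilson_D f y * wilson_A g y) x
      + (wilson_D ^^ n) (\<lambda>y. wilson_A f y * wilson_D g y) x"
proof -
  have step: "wilson_D (\<lambda>y. f y * g y) y
      = wilson_D f y * wilson_A g y + wilson_A f y * wilson_D g y"
    if "admissible (differentiable_pair f g) 1 y" for y
  proof (rule wilson_D_mult)
    assume "y = 0"
    then have "differentiable_pair f g 0" using that admissible_0 by auto
    then show "f field_differentiable at (- 1 / 4) \<and> g field_differentiable at (- 1 / 4)"
      using differentiable_of_orderD[of _ 0 0] by (auto simp: differentiable_pair_def)
  qed
  have "(wilson_D ^^ Suc n) (\<lambda>y. f y * g y) x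
      = (wilson_D ^^ n) (\<lambda>y. wilson_D f y * wilson_A g y + wilson_A f y * wilson_D g y) x"
    unfolding funpow_Suc_right comp_apply
    using assms(1) by (intro power_D_cong[OF step]) auto
  also have "\<dots> = (wilson_D ^^ n) (\<lambda>y. wilson_D f y * wilson_A g y) x
      + (wilson_D ^^ n) (\<lambda>y. wilson_A f y * wilson_D g y) x"
  proof (rule power_D_add, rule admissible_lower[OF assms(1)])
    fix r assume "r < n" and le: "\<And>s. s \<le> r + (Suc n - n) \<Longrightarrow> differentiable_pair f g s"
    have "differentiable_pair (wilson_D f) (wilson_A g) s"
      "differentiable_pair (wilson_A f) (wilson_D g) s" if "s \<le> r" for s
      using differentiable_pair_step[of s f g] le that by auto
    then show "(wilson_D ^^ r) (\<lambda>y. wilson_D f y * wilson_A g y) field_differentiable at (- 1 / 4)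
      \<and> (wilson_D ^^ r) (\<lambda>y. wilson_A f y * wilson_D g y) field_differentiable at (- 1 / 4)"
      using diff[OF \<open>r < n\<close>] by blast
  qed simp
  finally show ?thesis .
qed

lemma power_D_mult_differentiable:
  assumes "\<And>s. s \<le> r \<Longrightarrow> differentiable_pair f g s"
  shows "(wilson_D ^^ r) (\<lambda>y. f y * g y) field_differentiable at (- 1 / 4)"
  using assms
proof (induction r arbitrary: f g rule: less_induct)
  case (less r)
  show ?case
  proof (cases r)
    case 0
    with less.prems[of 0] show ?thesis
      using differentiable_of_orderD[of _ 0 0]
      by (auto simp: differentiable_pair_def intro: field_differentiable_mult)
  next
    case (Suc n)
    show ?thesis
    proof (rule field_differentiable_cong_admissible)
      fix x assume "admissible (differentiable_pair f g) r x"
      then show "(wilson_D ^^ r) (\<lambda>y. f y * g y) x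
          = (wilson_D ^^ n) (\<lambda>y. wilson_D f y * wilson_A g y) x
            + (wilson_D ^^ n) (\<lambda>y. wilson_A f y * wilson_D g y) x"
        unfolding Suc by (rule power_D_Suc_mult_if_differentiable) (rule less.IH, simp_all add: Suc)
    next
      have "differentiable_pair (wilson_D f) (wilson_A g) s"
        "differentiable_pair (wilson_A f) (wilson_D g) s" if "s \<le> n" for s
        using differentiable_pair_step[of s f g] less.prems that Suc by simp_all
      then show "(\<lambda>x. (wilson_D ^^ n) (\<lambda>y. wilson_D f y * wilson_A g y) x
          + (wilson_D ^^ n) (\<lambda>y. wilson_A f y * wilson_D g y) x)
          field_differentiable at (- 1 / 4)"
        using less.IH[of n] Suc by (intro field_differentiable_add) simp_all
    qed (simp add: less.prems)
  qed
qed

lemma power_D_Suc_mult: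
  assumes "admissible (differentiable_pair f g) (Suc n) x"
  shows "(wilson_D ^^ Suc n) (\<lambda>y. f y * g y) x
    = (wilson_D ^^ n) (\<lambda>y. wilson_D f y * wilson_A g y) x
      + (wilson_D ^^ n) (\<lambda>y. wilson_A f y * wilson_D g y) x"
  using assms power_D_mult_differentiable by (rule power_D_Suc_mult_if_differentiable)

section \<open>The coefficients\<close>

lemma wilson_C_0: "wilson_C n 0 = 1"
  by (simp add: wilson_C_def)

text \<open>
  For \<open>k < n\<close> the three coefficients have a common factor, and after dividing by it the recurrence
  reads \<open>n + k + 1 = (n - 1 - k) + 2 (k + 1)\<close>. The case distinction replaces \<open>wilson_C n (Suc n)\<close>
  by \<open>0\<close>, which matters for \<open>n = 0\<close>: the first branch of the definition gives it the value
  \<open>- 1 / 4\<close>.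
\<close>
lemma wilson_C_Suc:
  assumes "k \<le> n"
  shows "wilson_C (Suc n) (Suc k)
    = (if k < n then wilson_C n (Suc k) else 0) - of_nat (n + k) / 2 * wilson_C n k"
proof (cases "k = n")
  case True
  then show ?thesis by (simp add: wilson_C_def)
next
  case False
  with assms obtain d where n: "n = Suc (k + d)"
    by (metis add_Suc_right le_neq_implies_less less_iff_Suc_add)
  define N K F where "N = (of_nat (2 * k + d + 1) :: complex)" and "K = (of_nat (k + 1) :: complex)"
    and "F = (fact (2 * k + d) :: complex)"
  have f1: "fact (Suc (2 * k + d)) = N * F" and f3: "fact (Suc k) = K * fact k"
    and f2: "fact (Suc (Suc (2 * k + d))) = (of_nat d + 2 * K) * (N * F)"
    by (simp_all add: N_def K_def F_def algebra_simps)
  have "K \<noteq> 0" unfolding K_def by (subst of_nat_eq_0_iff) simp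
  have C1: "wilson_C (Suc n) (Suc k)
      = (- 1 / 4) ^ Suc k * (fact (Suc (Suc (2 * k + d))) / (fact d * fact (Suc k)))"
    by (simp add: wilson_C_def n mult_2 add_ac del: fact_Suc power_Suc)
  \<comment> \<open>Replacing \<open>1 / fact (d - 1)\<close> by \<open>d / fact d\<close> includes \<open>d = 0\<close>, where the coefficient vanishes.\<close>
  have C2: "wilson_C n (Suc k)
      = (- 1 / 4) ^ Suc k * (of_nat d * fact (Suc (2 * k + d)) / (fact d * fact (Suc k)))"
  proof (cases d)
    case (Suc e)
    have "of_nat d * a / (fact d * b) = a / (fact e * b)" for a b :: complex
      by (simp add: Suc del: of_nat_Suc)
    moreover have "wilson_C n (Suc k)
        = (- 1 / 4) ^ Suc k * (fact (Suc (2 * k + d)) / (fact e * fact (Suc k)))"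
      by (simp add: wilson_C_def n Suc mult_2 add_ac del: fact_Suc power_Suc)
    ultimately show ?thesis by (simp only:)
  qed (simp add: wilson_C_def n)
  have C3: "wilson_C n k = (- 1 / 4) ^ k * (F / (fact d * fact k))"
    by (simp add: wilson_C_def n F_def mult_2 add_ac)
  have nk: "of_nat (n + k) = N" by (simp add: n N_def)
  have "(- 1 / 4) * ((of_nat d + 2 * K) * (N * F) / (D * (K * E)))
      = (- 1 / 4) * (of_nat d * (N * F) / (D * (K * E))) - N / 2 * (F / (D * E))"
    if "D \<noteq> 0" "E \<noteq> 0" for D E
    using that \<open>K \<noteq> 0\<close> by (simp add: field_simps)
  from this[of "fact d" "fact k"]
  have "c * ((- 1 / 4) * ((of_nat d + 2 * K) * (N * F) / (fact d * (K * fact k))))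
      = c * ((- 1 / 4) * (of_nat d * (N * F) / (fact d * (K * fact k)))
        - N / 2 * (F / (fact d * fact k)))" for c
    by simp
  from this[of "(- 1 / 4) ^ k"] show ?thesis
    unfolding C1 C2 C3 f1 f2 f3 nk power_Suc using n
    by (simp only: right_diff_distrib mult_ac) simp
qed

lemma binomial_split:
  fixes T :: "nat \<Rightarrow> complex"
  shows "(\<Sum>j\<le>N. of_nat (N choose j) * (T (Suc j) + T j)) = (\<Sum>j\<le>Suc N. of_nat (Suc N choose j) * T j)"
proof -
  have "(\<Sum>j\<le>Suc N. of_nat (Suc N choose j) * T j)
      = T 0 + (\<Sum>j\<le>N. of_nat (N choose Suc j) * T (Suc j)) + (\<Sum>j\<le>N. of_nat (N choose j) * T (Suc j))"
    by (simp add: sum.atMost_Suc_shift sum.distrib distrib_right add_ac del: sum.atMost_Suc)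
  also have "T 0 + (\<Sum>j\<le>N. of_nat (N choose Suc j) * T (Suc j)) = (\<Sum>j\<le>Suc N. of_nat (N choose j) * T j)"
    by (simp add: sum.atMost_Suc_shift del: sum.atMost_Suc)
  also have "\<dots> = (\<Sum>j\<le>N. of_nat (N choose j) * T j)" by simp
  finally show ?thesis by (simp add: distrib_left sum.distrib)
qed

text \<open>
  With \<open>a p q = A\<^sup>p D\<^sup>q f\<close> and \<open>b p q = A\<^sup>p D\<^sup>q g\<close> at a fixed point, this is the inner sum of the
  formula. Its double sequences can be arbitrary, which separates the combinatorics of the
  induction step from the operators.
\<close>
definition ordered_term :: "(nat \<Rightarrow> nat \<Rightarrow> complex) \<Rightarrow> (nat \<Rightarrow> nat \<Rightarrow> complex) \<Rightarrow> nat \<Rightarrow> nat \<Rightarrow> complex"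
  where "ordered_term a b n k
    = (\<Sum>j\<le>n - k. of_nat ((n - k) choose j) * (a (n - k - j) (j + k) * b j (n - j)))"

text \<open>
  The arguments on the left are what \<open>D f\<close>, \<open>A g\<close> and \<open>A f\<close>, \<open>D g\<close> contribute after the inner \<open>A\<close>
  is moved to the left. The two corrections in summand \<open>j\<close> have the factors \<open>n - j\<close> and \<open>j + k\<close>,
  whose sum is free of \<open>j\<close>.
\<close>
lemma ordered_term_step:
  assumes "k \<le> n"
  shows "ordered_term (\<lambda>p q. a p (Suc q)) (\<lambda>p q. b (Suc p) q - of_nat q / 2 * b p (Suc q)) n k
    + ordered_term (\<lambda>p q. a (Suc p) q - of_nat q / 2 * a p (Suc q)) (\<lambda>p q. b p (Suc q)) n k
    = ordered_term a b (Suc n) k - of_nat (n + k) / 2 * ordered_term a b (Suc n) (Suc k)"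
proof -
  define N where "N = n - k"
  have n: "n = N + k" using assms by (simp add: N_def)
  \<comment> \<open>\<open>T\<close> and \<open>U\<close> are the summands of the terms of index \<open>k\<close> and \<open>k + 1\<close> on the right-hand side.\<close>
  define T where "T j = a (Suc N - j) (j + k) * b j (Suc n - j)" for j
  define U where "U j = a (N - j) (Suc (j + k)) * b j (Suc n - j)" for j
  have "ordered_term (\<lambda>p q. a p (Suc q)) (\<lambda>p q. b (Suc p) q - of_nat q / 2 * b p (Suc q)) n k
    + ordered_term (\<lambda>p q. a (Suc p) q - of_nat q / 2 * a p (Suc q)) (\<lambda>p q. b p (Suc q)) n k
    = (\<Sum>j\<le>N. of_nat (N choose j) * (T (Suc j) + T j - of_nat (n + k) / 2 * U j))"
    unfolding ordered_term_def N_def[symmetric] sum.distrib[symmetric]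
  proof (rule sum.cong[OF refl])
    fix j assume "j \<in> {..N}"
    then obtain i where N: "N = j + i" by (auto simp: le_iff_add)
    show "of_nat (N choose j) * (a (N - j) (Suc (j + k)) *
        (b (Suc j) (n - j) - of_nat (n - j) / 2 * b j (Suc (n - j)))) +
      of_nat (N choose j) * ((a (Suc (N - j)) (j + k) - of_nat (j + k) / 2 * a (N - j) (Suc (j + k)))
        * b j (Suc (n - j)))
      = of_nat (N choose j) * (T (Suc j) + T j - of_nat (n + k) / 2 * U j)"
      by (simp add: T_def U_def n N Suc_diff_le field_simps)
  qed
  also have "\<dots> = (\<Sum>j\<le>Suc N. of_nat (Suc N choose j) * T j)
      - of_nat (n + k) / 2 * (\<Sum>j\<le>N. of_nat (N choose j) * U j)"
    unfolding binomial_split[symmetric]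
    by (simp add: right_diff_distrib sum_subtractf sum_distrib_left mult_ac)
  finally show ?thesis
    by (simp add: ordered_term_def T_def U_def n del: sum.atMost_Suc binomial_Suc_Suc)
qed

lemma wilson_C_sum_step:
  "(\<Sum>k\<le>n. wilson_C n k * (S k - of_nat (n + k) / 2 * S (Suc k)))
    = (\<Sum>k\<le>Suc n. wilson_C (Suc n) k * S k)"
proof -
  have "(\<Sum>k\<le>Suc n. wilson_C (Suc n) k * S k)
      = S 0 + (\<Sum>k\<le>n. (if k < n then wilson_C n (Suc k) else 0) * S (Suc k))
        - (\<Sum>k\<le>n. of_nat (n + k) / 2 * wilson_C n k * S (Suc k))"
    unfolding sum.atMost_Suc_shift
    by (simp add: wilson_C_0 wilson_C_Suc left_diff_distrib sum_subtractf)
  also have "S 0 + (\<Sum>k\<le>n. (if k < n then wilson_C n (Suc k) else 0) * S (Suc k))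
      = (\<Sum>k\<le>n. wilson_C n k * S k)"
  proof (cases n)
    case (Suc m)
    have "(\<Sum>k\<le>n. (if k < n then wilson_C n (Suc k) else 0) * S (Suc k))
        = (\<Sum>k\<le>m. wilson_C n (Suc k) * S (Suc k))"
      by (simp add: Suc)
    then show ?thesis
      unfolding Suc sum.atMost_Suc_shift by (simp add: wilson_C_0)
  qed (simp add: wilson_C_0)
  finally show ?thesis
    by (simp add: right_diff_distrib sum_subtractf mult_ac)
qed

section \<open>The Leibniz rule\<close>

lemma power_D_mult:
  assumes "admissible (differentiable_pair f g) n x"
  shows "(wilson_D ^^ n) (\<lambda>y. f y * g y) x = (\<Sum>k\<le>n. wilson_C n k *
      ordered_term (\<lambda>p q. (wilson_A ^^ p) ((wilson_D ^^ q) f) x)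
        (\<lambda>p q. (wilson_A ^^ p) ((wilson_D ^^ q) g) x) n k)"
  using assms
proof (induction n arbitrary: f g)
  case 0
  then show ?case by (simp add: ordered_term_def wilson_C_0)
next
  case (Suc n)
  define a b where "a p q = (wilson_A ^^ p) ((wilson_D ^^ q) f) x"
    and "b p q = (wilson_A ^^ p) ((wilson_D ^^ q) g) x" for p q
  note adm = Suc.prems[unfolded admissible_pair]
  have shift: "(wilson_A ^^ p) ((wilson_D ^^ q) (wilson_D h)) x
      = (wilson_A ^^ p) ((wilson_D ^^ Suc q) h) x" for p q h
    by (simp add: funpow_swap1)
  have move: "(wilson_A ^^ p) ((wilson_D ^^ q) (wilson_A h)) x
      = (wilson_A ^^ Suc p) ((wilson_D ^^ q) h) x
        - of_nat q / 2 * (wilson_A ^^ p) ((wilson_D ^^ Suc q) h) x"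
    if "admissible (differentiable_of_order h) (Suc n) x" "p + q = n" for p q h
    using power_A_D_A that by blast
  have one: "(wilson_D ^^ n) (\<lambda>y. wilson_D f y * wilson_A g y) x = (\<Sum>k\<le>n. wilson_C n k *
      ordered_term (\<lambda>p q. a p (Suc q)) (\<lambda>p q. b (Suc p) q - of_nat q / 2 * b p (Suc q)) n k)"
    unfolding a_def b_def
    by (subst Suc.IH) (use adm in \<open>auto simp: admissible_pair admissible_A admissible_D
      ordered_term_def shift move simp del: funpow.simps intro!: sum.cong\<close>)
  have two: "(wilson_D ^^ n) (\<lambda>y. wilson_A f y * wilson_D g y) x = (\<Sum>k\<le>n. wilson_C n k *
      ordered_term (\<lambda>p q. a (Suc p) q - of_nat q / 2 * a p (Suc q)) (\<lambda>p q. b p (Suc q)) n k)"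
    unfolding a_def b_def
    by (subst Suc.IH) (use adm in \<open>auto simp: admissible_pair admissible_A admissible_D
      ordered_term_def shift move simp del: funpow.simps intro!: sum.cong\<close>)
  have "(wilson_D ^^ Suc n) (\<lambda>y. f y * g y) x = (\<Sum>k\<le>n. wilson_C n k *
      (ordered_term a b (Suc n) k - of_nat (n + k) / 2 * ordered_term a b (Suc n) (Suc k)))"
    unfolding power_D_Suc_mult[OF Suc.prems] one two sum.distrib[symmetric] distrib_left[symmetric]
    by (rule sum.cong[OF refl]) (simp only: atMost_iff ordered_term_step)
  then show ?case unfolding wilson_C_sum_step a_def b_def .
qed

theorem theorem2p3:
  fixes f g :: "complex \<Rightarrow> complex" and n :: nat and x :: complex
  assumes "wilson_defined n f x" and "wilson_defined n g x"
  shows "(wilson_D ^^ n) (\<lambda>y. f y * g y) x =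
    (\<Sum>k=0..n. wilson_C n k *
      (\<Sum>j=0..n - k. of_nat ((n - k) choose j) *
         ((wilson_A ^^ (n - k - j)) ((wilson_D ^^ (j + k)) f) x *
          (wilson_A ^^ j) ((wilson_D ^^ (n - j)) g) x)))"
  using power_D_mult[of f g n x] assms
  by (simp add: admissible_pair wilson_defined_iff_admissible ordered_term_def atLeast0AtMost)

end
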